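(* Let $R=\mathbb Z[u_{s,i}^{\pm1},u_{t,j}^{\pm1}]_{1\le i\le 2,\,1\le j\le 3}$ and let $$H_{G_{14}}=\Big\langle s,t\ \Big|\ stststst=tstststs,\ \prod_{i=1}^2(s-u_{s,i})=\prod_{j=1}^3(t-u_{t,j})=0\Big\rangle$$ be the generic Hecke algebra (an associative unital $R$-algebra) of $G_{14}$. Let $u_1,u_2$ be the $R$-subalgebras generated by $s$ and by $t$ respectively, let $z=(st)^4$, and let $$U=\sum_{k=0}^5\big(z^ku_1u_2u_1u_2+z^ku_1tst^{-1}su_2\big).$$ Then $H_{G_{14}}=U$.
   Context: For subsets $X,Y$ of an $R$-algebra, $XY$ denotes the $R$-submodule spanned by the products $xy$. The generators are invertible in the algebra because the parameters are invertible in $R$. *)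

theory Defs
  imports Complex_Main "HOL-Library.Poly_Mapping" "HOL-Library.Set_Algebras"
begin

text \<open>
  The Laurent polynomial ring in the five parameters, as the group ring over the integers of the
  free abelian group of exponent vectors (multiplication of \<^typ>\<open>'a \<Rightarrow>\<^sub>0 'b\<close> is convolution).
\<close>

datatype param = Us1 | Us2 | Ut1 | Ut2 | Ut3

type_synonym laurent = "(param \<Rightarrow>\<^sub>0 int) \<Rightarrow>\<^sub>0 int"

definition laurent_var :: "param \<Rightarrow> laurent" where
  "laurent_var p = Poly_Mapping.single (Poly_Mapping.single p 1) 1"

definition laurent_var_inv :: "param \<Rightarrow> laurent" where
  "laurent_var_inv p = Poly_Mapping.single (Poly_Mapping.single p (- 1)) 1"

lemma laurent_var_inv: "laurent_var p * laurent_var_inv p = 1"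
  by (simp add: laurent_var_def laurent_var_inv_def mult_single flip: single_add)

text \<open>
  The free monoid on the two generators is written additively, so that the free associative algebra
  is its monoid algebra.
\<close>

datatype gen = Gen_s | Gen_t

datatype gen_word = Word (letters: "gen list")

instantiation gen_word :: monoid_add
begin

definition zero_gen_word :: gen_word where
  "0 = Word []"

definition plus_gen_word :: "gen_word \<Rightarrow> gen_word \<Rightarrow> gen_word" where
  "v + w = Word (letters v @ letters w)"

instance
  by standard (simp_all add: zero_gen_word_def plus_gen_word_def)

end

type_synonym free_alg = "gen_word \<Rightarrow>\<^sub>0 laurent"

definition free_gen :: "gen \<Rightarrow> free_alg" where
  "free_gen g = Poly_Mapping.single (Word [g]) 1"

definition free_scalar :: "laurent \<Rightarrow> free_alg" where
  "free_scalar r = Poly_Mapping.single 0 r"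

definition relators :: "free_alg set" where
  "relators =
     (let s = free_gen Gen_s; t = free_gen Gen_t; u = (\<lambda>p. free_scalar (laurent_var p)) in
      {s * t * s * t * s * t * s * t - t * s * t * s * t * s * t * s,
       (s - u Us1) * (s - u Us2),
       (t - u Ut1) * (t - u Ut2) * (t - u Ut3)})"

inductive_set relation_ideal :: "free_alg set" where
  zero: "0 \<in> relation_ideal"
| relator: "x \<in> relators \<Longrightarrow> x \<in> relation_ideal"
| add: "x \<in> relation_ideal \<Longrightarrow> y \<in> relation_ideal \<Longrightarrow> x + y \<in> relation_ideal"
| mult_left: "x \<in> relation_ideal \<Longrightarrow> a * x \<in> relation_ideal"
| mult_right: "x \<in> relation_ideal \<Longrightarrow> x * a \<in> relation_ideal"

lemma relation_ideal_uminus: "x \<in> relation_ideal \<Longrightarrow> - x \<in> relation_ideal"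
  using relation_ideal.mult_left[of x "- 1"] by simp

lemma relation_ideal_diff:
  "x \<in> relation_ideal \<Longrightarrow> y \<in> relation_ideal \<Longrightarrow> x - y \<in> relation_ideal"
  using relation_ideal.add[OF _ relation_ideal_uminus, of x y] by simp

text \<open>
  The character sending \<open>s\<close> and \<open>t\<close> to their first parameters; it shows that the quotient below
  is nontrivial, which the class \<^class>\<open>ring_1\<close> demands.
\<close>

definition word_char :: "gen_word \<Rightarrow> laurent" where
  "word_char w =
     prod_list (map (\<lambda>g. case g of Gen_s \<Rightarrow> laurent_var Us1 | Gen_t \<Rightarrow> laurent_var Ut1) (letters w))"

lemma word_char_add: "word_char (v + w) = word_char v * word_char w"
  by (simp add: word_char_def plus_gen_word_def)

lemma word_char_0: "word_char 0 = 1"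
  by (simp add: word_char_def zero_gen_word_def)

definition free_char :: "free_alg \<Rightarrow> laurent" where
  "free_char f = (\<Sum>w\<in>Poly_Mapping.keys f. Poly_Mapping.lookup f w * word_char w)"

lemma free_char_add: "free_char (f + g) = free_char f + free_char g"
  unfolding free_char_def
  by (rule setsum_keys_plus_distrib[where f = "\<lambda>w r. r * word_char w"]) (simp_all add: algebra_simps)

lemma free_char_single: "free_char (Poly_Mapping.single w r) = r * word_char w"
  by (simp add: free_char_def)

lemma free_char_0: "free_char 0 = 0"
  by (simp add: free_char_def)

lemma free_char_uminus: "free_char (- f) = - free_char f"
  using free_char_add[of f "- f"] by (simp add: free_char_0 eq_neg_iff_add_eq_0 add.commute)

lemma free_char_diff: "free_char (f - g) = free_char f - free_char g"
  using free_char_add[of f "- g"] by (simp add: free_char_uminus)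

lemma free_alg_induct [case_names zero single add]:
  fixes f :: free_alg
  assumes "P 0" "\<And>w r. P (Poly_Mapping.single w r)" "\<And>f g. P f \<Longrightarrow> P g \<Longrightarrow> P (f + g)"
  shows "P f"
proof (induction f rule: update_induct)
  case const
  show ?case by (fact assms(1))
next
  case (update f w r)
  have "Poly_Mapping.update w r f = f + Poly_Mapping.single w r"
    using update(1)
    by (intro poly_mapping_eqI)
       (auto simp: lookup_add lookup_update lookup_single when_def in_keys_iff)
  then show ?case using assms update by simp
qed

lemma free_char_mult: "free_char (f * g) = free_char f * free_char g"
proof (induction f rule: free_alg_induct)
  case (single v q)
  show ?case
    by (induction g rule: free_alg_induct)
       (simp_all add: free_char_0 free_char_add free_char_single mult_single word_char_add
          distrib_left ac_simps)
qed (simp_all add: free_char_0 free_char_add distrib_right)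

lemma free_char_relation_ideal: "x \<in> relation_ideal \<Longrightarrow> free_char x = 0"
proof (induction rule: relation_ideal.induct)
  case (relator x)
  have "free_char (free_gen Gen_s) = laurent_var Us1" "free_char (free_gen Gen_t) = laurent_var Ut1"
    by (simp_all add: free_gen_def free_char_single word_char_def)
  moreover have "free_char (free_scalar r) = r" for r
    by (simp add: free_scalar_def free_char_single word_char_0)
  ultimately show ?case
    using relator by (auto simp: relators_def Let_def free_char_diff free_char_mult ac_simps)
qed (simp_all add: free_char_0 free_char_add free_char_mult)

quotient_type hecke = free_alg / "\<lambda>x y. x - y \<in> relation_ideal"
proof (rule equivpI)
  show "reflp (\<lambda>x y. x - y \<in> relation_ideal)"
    by (rule reflpI) (simp add: relation_ideal.zero)
  show "symp (\<lambda>x y. x - y \<in> relation_ideal)"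
    by (rule sympI) (drule relation_ideal_uminus, simp)
  show "transp (\<lambda>x y. x - y \<in> relation_ideal)"
  proof (rule transpI)
    fix x y z :: free_alg
    assume "x - y \<in> relation_ideal" "y - z \<in> relation_ideal"
    then have "(x - y) + (y - z) \<in> relation_ideal" by (rule relation_ideal.add)
    then show "x - z \<in> relation_ideal" by simp
  qed
qed

instantiation hecke :: ring_1
begin

lift_definition zero_hecke :: hecke is 0 .

lift_definition one_hecke :: hecke is 1 .

lift_definition plus_hecke :: "hecke \<Rightarrow> hecke \<Rightarrow> hecke" is "(+)"
proof -
  fix a b c d :: free_alg
  assume "a - b \<in> relation_ideal" "c - d \<in> relation_ideal"
  then have "(a - b) + (c - d) \<in> relation_ideal" by (rule relation_ideal.add)
  then show "a + c - (b + d) \<in> relation_ideal" by (simp add: algebra_simps)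
qed

lift_definition uminus_hecke :: "hecke \<Rightarrow> hecke" is uminus
proof -
  fix a b :: free_alg
  assume "a - b \<in> relation_ideal"
  then have "- (a - b) \<in> relation_ideal" by (rule relation_ideal_uminus)
  then show "- a - - b \<in> relation_ideal" by simp
qed

lift_definition minus_hecke :: "hecke \<Rightarrow> hecke \<Rightarrow> hecke" is "(-)"
proof -
  fix a b c d :: free_alg
  assume "a - b \<in> relation_ideal" "c - d \<in> relation_ideal"
  then have "(a - b) - (c - d) \<in> relation_ideal" by (rule relation_ideal_diff)
  then show "a - c - (b - d) \<in> relation_ideal" by (simp add: algebra_simps)
qed

lift_definition times_hecke :: "hecke \<Rightarrow> hecke \<Rightarrow> hecke" is "(*)"
proof -
  fix a b c d :: free_alg
  assume "a - b \<in> relation_ideal" "c - d \<in> relation_ideal"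
  then have "(a - b) * c + b * (c - d) \<in> relation_ideal"
    by (intro relation_ideal.add relation_ideal.mult_left relation_ideal.mult_right)
  then show "a * c - b * d \<in> relation_ideal" by (simp add: algebra_simps)
qed

instance
proof
  show "(0::hecke) \<noteq> 1"
  proof transfer
    have "free_char 1 = 1"
      using free_char_single[of 0 1] by (simp add: word_char_0)
    then show "(0::free_alg) - 1 \<notin> relation_ideal"
      using free_char_relation_ideal[of "0 - 1"] by (auto simp: free_char_uminus)
  qed
qed (transfer; simp add: algebra_simps relation_ideal.zero)+

end

lift_definition hecke_scale :: "laurent \<Rightarrow> hecke \<Rightarrow> hecke" (infixr "\<cdot>" 75)
  is "\<lambda>r x. free_scalar r * x"
  by (simp add: relation_ideal.mult_left flip: right_diff_distrib)

lemma free_scalar_commute: "free_scalar r * f = f * free_scalar r"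
  unfolding free_scalar_def
  by (induction f rule: free_alg_induct)
     (simp_all add: distrib_left distrib_right mult_single mult.commute)

global_interpretation hecke: module hecke_scale
proof
  fix a b :: laurent and x y :: hecke
  show "a \<cdot> (x + y) = a \<cdot> x + a \<cdot> y"
    by transfer (simp add: algebra_simps relation_ideal.zero)
  show "(a + b) \<cdot> x = a \<cdot> x + b \<cdot> x"
    by transfer (simp add: free_scalar_def single_add algebra_simps relation_ideal.zero)
  show "a \<cdot> b \<cdot> x = (a * b) \<cdot> x"
    by transfer
      (simp add: free_scalar_def mult_single relation_ideal.zero flip: mult.assoc)
  show "1 \<cdot> x = x"
    by transfer (simp add: free_scalar_def relation_ideal.zero)
qed

lemma hecke_scale_mult:
  "(r \<cdot> x) * y = r \<cdot> (x * y)" "x * (r \<cdot> y) = r \<cdot> (x * y)"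
proof -
  show "(r \<cdot> x) * y = r \<cdot> (x * y)"
    by transfer (simp add: mult.assoc relation_ideal.zero)
  show "x * (r \<cdot> y) = r \<cdot> (x * y)"
  proof transfer
    fix r x y
    have "x * (free_scalar r * y) = free_scalar r * (x * y)"
      by (metis free_scalar_commute mult.assoc)
    then show "x * (free_scalar r * y) - free_scalar r * (x * y) \<in> relation_ideal"
      by (simp add: relation_ideal.zero)
  qed
qed

lift_definition hecke_s :: hecke is "free_gen Gen_s" .

lift_definition hecke_t :: hecke is "free_gen Gen_t" .

lemma hecke_scalar: "abs_hecke (free_scalar r) = r \<cdot> 1"
  by (simp add: hecke_scale.abs_eq one_hecke.abs_eq)

lemma hecke_relations:
  "hecke_s * hecke_t * hecke_s * hecke_t * hecke_s * hecke_t * hecke_s * hecke_t =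
   hecke_t * hecke_s * hecke_t * hecke_s * hecke_t * hecke_s * hecke_t * hecke_s"
  "(hecke_s - laurent_var Us1 \<cdot> 1) * (hecke_s - laurent_var Us2 \<cdot> 1) = 0"
  "(hecke_t - laurent_var Ut1 \<cdot> 1) * (hecke_t - laurent_var Ut2 \<cdot> 1) *
   (hecke_t - laurent_var Ut3 \<cdot> 1) = 0"
  by (transfer; rule relation_ideal.relator; simp add: relators_def Let_def)+

definition subalgebra :: "hecke set \<Rightarrow> bool" where
  "subalgebra A \<longleftrightarrow> hecke.subspace A \<and> 1 \<in> A \<and> (\<forall>x\<in>A. \<forall>y\<in>A. x * y \<in> A)"

text \<open>Junk unless \<open>x\<close> is invertible; \<open>hecke_t_inverse\<close> below shows that \<open>t\<close> is.\<close>

definition ring_inverse :: "'a::monoid_mult \<Rightarrow> 'a" where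
  "ring_inverse x = (THE y. x * y = 1 \<and> y * x = 1)"

lemma ring_inverse_eqI:
  assumes "x * y = 1" "y * x = 1"
  shows "ring_inverse x = y"
  unfolding ring_inverse_def using assms by (intro the_equality) (auto, metis mult.assoc mult.left_neutral mult.right_neutral)

lemma hecke_t_inverse:
  "hecke_t * ring_inverse hecke_t = 1" "ring_inverse hecke_t * hecke_t = 1"
proof -
  define a b c where "a = laurent_var Ut1" and "b = laurent_var Ut2" and "c = laurent_var Ut3"
  define d where "d = laurent_var_inv Ut1 * laurent_var_inv Ut2 * laurent_var_inv Ut3"
  define t where "t = hecke_t"
  define y where "y = d \<cdot> (t * t - (a + b + c) \<cdot> t + (a * b + a * c + b * c) \<cdot> 1)"
  have "a * b * c * d =
      (a * laurent_var_inv Ut1) * (b * laurent_var_inv Ut2) * (c * laurent_var_inv Ut3)"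
    by (simp add: d_def ac_simps)
  then have d: "d * (a * (b * c)) = 1"
    by (simp add: a_def b_def c_def laurent_var_inv ac_simps)
  have "(t - a \<cdot> 1) * (t - b \<cdot> 1) * (t - c \<cdot> 1) = 0"
    unfolding t_def a_def b_def c_def by (rule hecke_relations)
  then have "t * (t * t) - (a + b + c) \<cdot> (t * t) + (a * b + a * c + b * c) \<cdot> t = (a * (b * c)) \<cdot> 1"
    by (simp add: left_diff_distrib right_diff_distrib hecke_scale_mult mult.assoc
        hecke.scale_left_distrib hecke.scale_right_diff_distrib)
       (simp add: algebra_simps)
  then have *: "d \<cdot> (t * (t * t) - (a + b + c) \<cdot> (t * t) + (a * b + a * c + b * c) \<cdot> t) = 1"
    by (simp add: d)
  have "t * y = d \<cdot> (t * (t * t) - (a + b + c) \<cdot> (t * t) + (a * b + a * c + b * c) \<cdot> t)"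
    by (simp add: y_def hecke_scale_mult distrib_left right_diff_distrib)
  moreover have "y * t = d \<cdot> (t * (t * t) - (a + b + c) \<cdot> (t * t) + (a * b + a * c + b * c) \<cdot> t)"
    by (simp add: y_def hecke_scale_mult distrib_right left_diff_distrib mult.assoc)
  ultimately have "t * y = 1" "y * t = 1"
    using * by simp_all
  then show "hecke_t * ring_inverse hecke_t = 1" "ring_inverse hecke_t * hecke_t = 1"
    using ring_inverse_eqI[of t y] by (simp_all add: t_def)
qed

definition span_prod :: "hecke set \<Rightarrow> hecke set \<Rightarrow> hecke set" (infixl "\<odot>" 70) where
  "X \<odot> Y = hecke.span {x * y |x y. x \<in> X \<and> y \<in> Y}"

definition hecke_u1 :: "hecke set" where
  "hecke_u1 = subalgebra hull {hecke_s}"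

definition hecke_u2 :: "hecke set" where
  "hecke_u2 = subalgebra hull {hecke_t}"

definition hecke_z :: hecke where
  "hecke_z = (hecke_s * hecke_t) ^ 4"

text \<open>The sums below are Minkowski sums of sets.\<close>

definition hecke_U :: "hecke set" where
  "hecke_U =
     (\<Sum>k=0..5. {hecke_z ^ k} \<odot> hecke_u1 \<odot> hecke_u2 \<odot> hecke_u1 \<odot> hecke_u2 +
        {hecke_z ^ k} \<odot> hecke_u1 \<odot> {hecke_t * hecke_s * ring_inverse hecke_t * hecke_s} \<odot> hecke_u2)"

end

theory Submission
  imports Defs
begin

text \<open>
  Put \<open>x = st\<close>, so that \<open>x\<^sup>4 = z\<close> is central and the braid group modulo \<open>z\<close> is the free product of
  \<open>\<langle>x\<rangle>\<close> (of order 4) and \<open>\<langle>s\<rangle>\<close>. Let \<open>V\<close> be the span of the 144 elements \<open>z\<^sup>k u w v\<close> with \<open>0 \<le> k \<le> 5\<close>,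
  \<open>u \<in> {1, s}\<close>, \<open>w \<in> {1, ts, t\<^sup>-\<^sup>1s, tst\<^sup>-\<^sup>1s}\<close>, \<open>v \<in> {1, t, t\<^sup>-\<^sup>1}\<close>. It lies in \<open>U\<close>, contains \<open>1\<close>, and is
  stable under \<open>s\<close> on the left and \<open>t\<close> on the right, so it suffices that \<open>V\<close> is stable under \<open>t\<^sup>-\<^sup>1\<close> on the
  left, which comes down to \<open>z\<^sup>k t\<^sup>-\<^sup>2s\<close>, \<open>z\<^sup>k t\<^sup>-\<^sup>1sts\<close>, \<open>z\<^sup>k t\<^sup>-\<^sup>1st\<^sup>-\<^sup>1s\<close> and \<open>z\<^sup>k t\<^sup>-\<^sup>1stst\<^sup>-\<^sup>1s\<close> lying in \<open>V\<close>.

  Since the quadratic and cubic relations have invertible constant terms, if \<open>V\<close> contains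
  \<open>p s\<^sup>i q\<close> for two consecutive values of \<open>i\<close>, or \<open>p t\<^sup>i q\<close> for three consecutive values, then it
  contains the next one on either side. These two rules, applied to braid group elements up to
  left multiplication by powers of \<open>s\<close> and right multiplication by powers of \<open>t\<close>, already give the
  four families. The derivation was found by a computer search; checking it amounts to
  comparing normal forms in the free product.
\<close>

section \<open>Parameters, inverses and the central element\<close>

text \<open>The inverse is a parameter, so that one definition serves \<open>s\<close>,
  \<open>t\<close> and the explicitly given inverse \<open>hecke_zi\<close> of \<open>z\<close>. The
  exponent laws assume that \<open>u\<close> and \<open>v\<close> are mutually inverse.\<close>

definition int_power :: "'a::monoid_mult \<Rightarrow> 'a \<Rightarrow> int \<Rightarrow> 'a" where
  "int_power u v n = (if 0 \<le> n then u ^ nat n else v ^ nat (- n))"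

lemma int_power_simps [simp]:
  "int_power u v 0 = 1" "int_power u v 1 = u" "int_power u v (- 1) = v"
  by (simp_all add: int_power_def)

lemma int_power_of_nat [simp]: "int_power u v (int n) = u ^ n"
  by (simp add: int_power_def)

lemma int_power_commute:
  assumes "y * u = u * y" "y * v = v * y"
  shows "y * int_power u v n = int_power u v n * y"
  using assms by (simp add: int_power_def power_commuting_commutes)

lemma int_power_add_1:
  assumes "u * v = 1" "v * u = 1"
  shows "int_power u v (n + 1) = int_power u v n * u"
proof (cases "0 \<le> n")
  case True
  then show ?thesis by (simp add: int_power_def nat_add_distrib power_Suc2 del: power_Suc)
next
  case False
  then have "nat (- n) = Suc (nat (- (n + 1)))" by simp
  then have "int_power u v n = v ^ nat (- (n + 1)) * v" using False
    by (simp add: int_power_def power_Suc2 del: power_Suc)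
  then show ?thesis using assms False by (auto simp: int_power_def mult.assoc)
qed

lemma int_power_diff_1:
  assumes "u * v = 1" "v * u = 1"
  shows "int_power u v (n - 1) = int_power u v n * v"
  using int_power_add_1[OF assms, of "n - 1"] assms by (simp add: mult.assoc)

lemma int_power_add:
  assumes "u * v = 1" "v * u = 1"
  shows "int_power u v (m + n) = int_power u v m * int_power u v n"
proof (induction n rule: int_induct[where k = 0])
  case base
  show ?case by simp
next
  case (step1 i)
  then show ?case
    using int_power_add_1[OF assms, of "m + i"] int_power_add_1[OF assms, of i]
    by (simp add: mult.assoc add.assoc)
next
  case (step2 i)
  then show ?case
    using int_power_diff_1[OF assms, of "m + i"] int_power_diff_1[OF assms, of i]
    by (metis add_diff_eq mult.assoc)
qed

abbreviation hecke_si :: hecke where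
  "hecke_si \<equiv> ring_inverse hecke_s"

abbreviation hecke_ti :: hecke where
  "hecke_ti \<equiv> ring_inverse hecke_t"

text \<open>Here and in \<open>hecke_t_cubic\<close> the coefficients are symmetric functions of the
  parameters. Later arguments use only the shape of the relation and that its constant term is a
  unit.\<close>

lemma hecke_s_quadratic:
  obtains a b b' where "b * b' = 1" "hecke_s * hecke_s = a \<cdot> hecke_s - b \<cdot> 1"
proof
  let ?a = "laurent_var Us1" and ?b = "laurent_var Us2"
  have "?a * ?b * (laurent_var_inv Us1 * laurent_var_inv Us2) =
      (?a * laurent_var_inv Us1) * (?b * laurent_var_inv Us2)"
    by (simp only: ac_simps)
  then show "?a * ?b * (laurent_var_inv Us1 * laurent_var_inv Us2) = 1"
    by (simp add: laurent_var_inv)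
  show "hecke_s * hecke_s = (?a + ?b) \<cdot> hecke_s - (?a * ?b) \<cdot> 1"
    using hecke_relations(2)
    by (simp add: left_diff_distrib right_diff_distrib hecke_scale_mult
        hecke.scale_left_distrib hecke.scale_right_diff_distrib algebra_simps)
qed

lemma hecke_t_cubic:
  obtains a b c c' where "c * c' = 1"
    "hecke_t * hecke_t * hecke_t = a \<cdot> (hecke_t * hecke_t) - b \<cdot> hecke_t + c \<cdot> 1"
proof
  let ?a = "laurent_var Ut1" and ?b = "laurent_var Ut2" and ?c = "laurent_var Ut3"
  have "?a * ?b * ?c * (laurent_var_inv Ut1 * laurent_var_inv Ut2 * laurent_var_inv Ut3) =
      (?a * laurent_var_inv Ut1) * (?b * laurent_var_inv Ut2) * (?c * laurent_var_inv Ut3)"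
    by (simp only: ac_simps)
  then show "?a * ?b * ?c * (laurent_var_inv Ut1 * laurent_var_inv Ut2 * laurent_var_inv Ut3) = 1"
    by (simp add: laurent_var_inv)
  show "hecke_t * hecke_t * hecke_t =
      (?a + ?b + ?c) \<cdot> (hecke_t * hecke_t) - (?a * ?b + ?a * ?c + ?b * ?c) \<cdot> hecke_t
        + (?a * ?b * ?c) \<cdot> 1"
    using hecke_relations(3)
    by (simp add: left_diff_distrib right_diff_distrib hecke_scale_mult mult.assoc
        hecke.scale_left_distrib hecke.scale_right_diff_distrib)
       (simp add: algebra_simps)
qed

lemma hecke_s_inverse: "hecke_s * hecke_si = 1" "hecke_si * hecke_s = 1"
proof -
  obtain a b b' where b: "b * b' = 1" and s: "hecke_s * hecke_s = a \<cdot> hecke_s - b \<cdot> 1"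
    by (rule hecke_s_quadratic)
  define y where "y = b' \<cdot> (a \<cdot> 1 - hecke_s)"
  have "hecke_s * y = 1" "y * hecke_s = 1"
    using b by (simp_all add: y_def hecke_scale_mult left_diff_distrib right_diff_distrib s mult.commute)
  then show "hecke_s * hecke_si = 1" "hecke_si * hecke_s = 1"
    using ring_inverse_eqI[of hecke_s y] by simp_all
qed

lemma inverse_cancel:
  "hecke_s * (hecke_si * y) = y" "hecke_si * (hecke_s * y) = y"
  "hecke_t * (hecke_ti * y) = y" "hecke_ti * (hecke_t * y) = y"
  by (simp_all add: hecke_s_inverse hecke_t_inverse flip: mult.assoc)

lemma hecke_si_eq: obtains a b where "hecke_si = a \<cdot> 1 - b \<cdot> hecke_s"
proof -
  obtain a b b' where b: "b * b' = 1" and s: "hecke_s * hecke_s = a \<cdot> hecke_s - b \<cdot> 1"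
    by (rule hecke_s_quadratic)
  have "hecke_s = a \<cdot> 1 - b \<cdot> hecke_si"
    using arg_cong[OF s, of "\<lambda>y. hecke_si * y"]
    by (simp add: right_diff_distrib hecke_scale_mult hecke_s_inverse inverse_cancel)
  then have "b' \<cdot> hecke_s = (b' * a) \<cdot> 1 - hecke_si"
    using b by (metis hecke.scale_right_diff_distrib hecke.scale_scale hecke.scale_one mult.commute)
  then show ?thesis
    by (intro that[of "b' * a" b']) simp
qed

text \<open>This is the cubic relation times \<open>t^-2\<close>. It will turn left stability under
  \<open>t^-1\<close> into left stability under \<open>t\<close>.\<close>

lemma hecke_t_eq: obtains a b c where "hecke_t = a \<cdot> 1 - b \<cdot> hecke_ti + c \<cdot> (hecke_ti * hecke_ti)"
proof -
  obtain a b c c' where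
    "hecke_t * hecke_t * hecke_t = a \<cdot> (hecke_t * hecke_t) - b \<cdot> hecke_t + c \<cdot> 1"
    by (rule hecke_t_cubic)
  from arg_cong[OF this, of "\<lambda>y. y * hecke_ti * hecke_ti"]
  have "hecke_t = a \<cdot> 1 - b \<cdot> hecke_ti + c \<cdot> (hecke_ti * hecke_ti)"
    by (simp add: right_diff_distrib left_diff_distrib distrib_right hecke_scale_mult mult.assoc
        hecke_t_inverse inverse_cancel)
  then show ?thesis by (rule that)
qed

lemma hecke_ti_eq: obtains a b c where "hecke_ti = a \<cdot> 1 - b \<cdot> hecke_t + c \<cdot> (hecke_t * hecke_t)"
proof -
  obtain a b c c' where c: "c * c' = 1" and
    "hecke_t * hecke_t * hecke_t = a \<cdot> (hecke_t * hecke_t) - b \<cdot> hecke_t + c \<cdot> 1"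
    by (rule hecke_t_cubic)
  from arg_cong[OF this(2), of "\<lambda>y. c' \<cdot> (y * hecke_ti)"]
  have "c' \<cdot> (hecke_t * hecke_t) = (c' * a) \<cdot> hecke_t - (c' * b) \<cdot> 1 + hecke_ti"
    using c by (simp add: right_diff_distrib left_diff_distrib distrib_right hecke_scale_mult mult.assoc
        hecke_t_inverse inverse_cancel hecke.scale_right_distrib hecke.scale_right_diff_distrib mult.commute)
  then show ?thesis
    by (intro that[of "c' * b" "c' * a" c']) (simp add: algebra_simps)
qed

fun signed_gen :: "gen \<Rightarrow> bool \<Rightarrow> hecke" where
  "signed_gen Gen_s d = (if d then hecke_s else hecke_si)"
| "signed_gen Gen_t d = (if d then hecke_t else hecke_ti)"

fun gen_degree :: "gen \<Rightarrow> nat" where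
  "gen_degree Gen_s = 2"
| "gen_degree Gen_t = 3"

text \<open>This is the algebra behind each derivation step. For positive powers the unit constant
  term lets the relation be solved for 1; for negative powers the monic relation is multiplied by
  the inverse of its leading power.\<close>

lemma one_in_span_powers: "1 \<in> hecke.span ((\<lambda>i. signed_gen g d ^ i) ` {1..gen_degree g})"
proof (cases g)
  case Gen_s
  let ?S = "(\<lambda>i. signed_gen g d ^ i) ` {1..gen_degree g}"
  obtain a b b' where b: "b * b' = 1" and s: "hecke_s * hecke_s = a \<cdot> hecke_s - b \<cdot> 1"
    by (rule hecke_s_quadratic)
  have *: "signed_gen g d ^ 1 \<in> hecke.span ?S" "signed_gen g d ^ 2 \<in> hecke.span ?S"
    by (intro hecke.span_base imageI; simp add: Gen_s)+
  have "1 = a \<cdot> hecke_si - b \<cdot> (hecke_si * hecke_si)"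
    using arg_cong[OF s, of "\<lambda>y. y * hecke_si * hecke_si"]
    by (simp add: left_diff_distrib hecke_scale_mult mult.assoc inverse_cancel hecke_s_inverse)
  then have "1 = (if d then b' \<cdot> (a \<cdot> signed_gen g d ^ 1 - signed_gen g d ^ 2)
      else a \<cdot> signed_gen g d ^ 1 - b \<cdot> signed_gen g d ^ 2)"
    using b by (auto simp: Gen_s power2_eq_square s mult.commute)
  also have "\<dots> \<in> hecke.span ?S"
    using * by (auto intro!: hecke.span_diff hecke.span_scale)
  finally show ?thesis .
next
  case Gen_t
  let ?S = "(\<lambda>i. signed_gen g d ^ i) ` {1..gen_degree g}"
  obtain a b c c' where c: "c * c' = 1" and
    t: "hecke_t * hecke_t * hecke_t = a \<cdot> (hecke_t * hecke_t) - b \<cdot> hecke_t + c \<cdot> 1"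
    by (rule hecke_t_cubic)
  have *: "signed_gen g d ^ 1 \<in> hecke.span ?S" "signed_gen g d ^ 2 \<in> hecke.span ?S"
      "signed_gen g d ^ 3 \<in> hecke.span ?S"
    by (intro hecke.span_base imageI; simp add: Gen_t)+
  have "1 = a \<cdot> hecke_ti - b \<cdot> (hecke_ti * hecke_ti) + c \<cdot> (hecke_ti * hecke_ti * hecke_ti)"
    using arg_cong[OF t, of "\<lambda>y. y * hecke_ti * hecke_ti * hecke_ti"]
    by (simp add: left_diff_distrib distrib_right hecke_scale_mult mult.assoc inverse_cancel
        hecke_t_inverse)
  then have "1 = (if d then c' \<cdot> (signed_gen g d ^ 3 - a \<cdot> signed_gen g d ^ 2 + b \<cdot> signed_gen g d ^ 1)
      else a \<cdot> signed_gen g d ^ 1 - b \<cdot> signed_gen g d ^ 2 + c \<cdot> signed_gen g d ^ 3)"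
    using c by (auto simp: Gen_t power2_eq_square power3_eq_cube t mult.commute)
  also have "\<dots> \<in> hecke.span ?S"
    using * by (auto intro!: hecke.span_diff hecke.span_scale hecke.span_add)
  finally show ?thesis .
qed

section \<open>The central element and integer powers\<close>

definition hecke_x :: hecke where
  "hecke_x = hecke_s * hecke_t"

definition hecke_zi :: hecke where
  "hecke_zi = (hecke_ti * hecke_si) ^ 4"

lemma hecke_z_eq: "hecke_z = hecke_x * hecke_x * hecke_x * hecke_x"
  by (simp add: hecke_z_def hecke_x_def eval_nat_numeral mult.assoc)

lemma hecke_z_inverse: "hecke_z * hecke_zi = 1" "hecke_zi * hecke_z = 1"
  by (simp_all add: hecke_z_def hecke_zi_def eval_nat_numeral mult.assoc inverse_cancel
      hecke_s_inverse hecke_t_inverse)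

text \<open>The braid relation says \<open>z = (st)^4 = (ts)^4\<close>, and
  \<open>s (ts)^4 = (st)^4 s\<close>, \<open>t (st)^4 = (ts)^4 t\<close> hold by
  associativity.\<close>

lemma hecke_z_commute: "hecke_s * hecke_z = hecke_z * hecke_s" "hecke_t * hecke_z = hecke_z * hecke_t"
proof -
  have 1: "hecke_z = hecke_t * hecke_s * hecke_t * hecke_s * hecke_t * hecke_s * hecke_t * hecke_s"
    using hecke_relations(1) by (simp add: hecke_z_def eval_nat_numeral mult.assoc)
  have 2: "hecke_z = hecke_s * hecke_t * hecke_s * hecke_t * hecke_s * hecke_t * hecke_s * hecke_t"
    by (simp add: hecke_z_def eval_nat_numeral mult.assoc)
  show "hecke_s * hecke_z = hecke_z * hecke_s"
    by (subst 1, subst 2) (simp add: mult.assoc)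
  show "hecke_t * hecke_z = hecke_z * hecke_t"
    by (subst 2, subst 1) (simp add: mult.assoc)
qed

lemma commute_inverse:
  fixes y :: "'a::monoid_mult"
  assumes "u * v = 1" "v * u = 1" "y * u = u * y"
  shows "y * v = v * y"
proof -
  have "v * (u * y) * v = v * (y * u) * v" using assms by simp
  then show ?thesis using assms by (metis mult.assoc mult.left_neutral mult.right_neutral)
qed

abbreviation s_pow :: "int \<Rightarrow> hecke" where
  "s_pow \<equiv> int_power hecke_s hecke_si"

abbreviation t_pow :: "int \<Rightarrow> hecke" where
  "t_pow \<equiv> int_power hecke_t hecke_ti"

abbreviation z_pow :: "int \<Rightarrow> hecke" where
  "z_pow \<equiv> int_power hecke_z hecke_zi"

lemmas s_pow_add = int_power_add[OF hecke_s_inverse]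
lemmas t_pow_add = int_power_add[OF hecke_t_inverse]
lemmas z_pow_add = int_power_add[OF hecke_z_inverse]

lemma z_pow_commute_gens:
  "hecke_s * z_pow k = z_pow k * hecke_s" "hecke_t * z_pow k = z_pow k * hecke_t"
  by (intro int_power_commute hecke_z_commute commute_inverse[OF hecke_z_inverse])+

lemma z_pow_commute_s_pow: "s_pow n * z_pow k = z_pow k * s_pow n"
proof -
  have "z_pow k * hecke_s = hecke_s * z_pow k" by (simp add: z_pow_commute_gens)
  then show ?thesis
    using int_power_commute[of "z_pow k" hecke_s hecke_si n]
      commute_inverse[OF hecke_s_inverse, of "z_pow k"] by simp
qed

lemma z_pow_commute_ti: "hecke_ti * z_pow k = z_pow k * hecke_ti"
  using commute_inverse[OF hecke_t_inverse, of "z_pow k"] by (simp add: z_pow_commute_gens)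

section \<open>Normal forms of braid group elements\<close>

text \<open>
  The pair \<open>(k, [c\<^sub>1, \<dots>, c\<^sub>n])\<close> stands for \<open>z\<^sup>k x s\<^sup>c\<^sub>n \<dots> x s\<^sup>c\<^sub>1\<close>: the head of the list belongs to the
  right end of the product, and powers of \<open>s\<close> at the left end are not recorded.
\<close>

type_synonym code = "int \<times> int list"

fun word :: "int list \<Rightarrow> hecke" where
  "word [] = 1"
| "word (c # cs) = word cs * hecke_x * s_pow c"

fun element :: "code \<Rightarrow> hecke" where
  "element (k, cs) = z_pow k * word cs"

text \<open>The power of \<open>s\<close> on the left stays unspecified because membership in a
  submodule stable under \<open>s\<close> and \<open>s^-1\<close> on the left does not depend on
  it.\<close>

definition represents :: "code \<Rightarrow> hecke \<Rightarrow> bool" where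
  "represents w y \<longleftrightarrow> (\<exists>i. y = s_pow i * element w)"

lemma word_append: "word (cs @ ds) = word ds * word cs"
  by (induction cs) (simp_all add: mult.assoc)

lemma represents_element: "represents w (element w)"
  unfolding represents_def by (rule exI[of _ 0]) simp

lemma represents_append: "represents (k, cs) y \<Longrightarrow> represents (k, ds @ cs) (y * word ds)"
  by (auto simp: represents_def word_append mult.assoc)

lemma represents_Cons: "represents (k, cs) y \<Longrightarrow> represents (k, c # cs) (y * hecke_x * s_pow c)"
  using represents_append[of k cs y "[c]"] by (simp add: mult.assoc)

text \<open>For the empty list the factor \<open>s^c\<close> commutes past \<open>z^k\<close> to the
  left end, where powers of \<open>s\<close> are not recorded.\<close>

fun add_last :: "int \<Rightarrow> int list \<Rightarrow> int list" where
  "add_last c [] = []"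
| "add_last c (d # ds) = (d + c) # ds"

lemma represents_add_last:
  assumes "represents (k, cs) y"
  shows "represents (k, add_last c cs) (y * s_pow c)"
proof -
  obtain i where y: "y = s_pow i * (z_pow k * word cs)"
    using assms by (auto simp: represents_def)
  show ?thesis
  proof (cases cs)
    case Nil
    then have "y * s_pow c = s_pow (i + c) * z_pow k"
      by (simp add: y mult.assoc s_pow_add flip: z_pow_commute_s_pow)
    then show ?thesis using Nil by (auto simp: represents_def)
  next
    case (Cons d ds)
    then show ?thesis by (auto simp: y represents_def mult.assoc s_pow_add)
  qed
qed

lemma word_commute_z: "word cs * hecke_z = hecke_z * word cs"
proof (induction cs)
  case (Cons c cs)
  have "s_pow c * hecke_z = hecke_z * s_pow c"
    using z_pow_commute_s_pow[of c 1] by simp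
  moreover have "hecke_x * hecke_z = hecke_z * hecke_x"
    by (metis hecke_x_def hecke_z_commute mult.assoc)
  ultimately show ?case using Cons by (simp add: mult.assoc) (metis mult.assoc)
qed simp

lemma represents_z:
  assumes "represents (k, cs) y"
  shows "represents (k + 1, cs) (y * hecke_z)" "represents (k - 1, cs) (y * hecke_zi)"
proof -
  obtain i where y: "y = s_pow i * (z_pow k * word cs)"
    using assms by (auto simp: represents_def)
  have "z_pow (k + 1) = z_pow k * hecke_z" "z_pow (k - 1) = z_pow k * hecke_zi"
    using z_pow_add[of k 1] z_pow_add[of k "- 1"] by simp_all
  moreover have "word cs * hecke_zi = hecke_zi * word cs"
    by (intro commute_inverse[OF hecke_z_inverse] word_commute_z)
  ultimately show "represents (k + 1, cs) (y * hecke_z)" "represents (k - 1, cs) (y * hecke_zi)"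
    by (auto simp: represents_def y mult.assoc word_commute_z intro!: exI[of _ i])
qed

text \<open>Appends \<open>x s\<^sup>c\<close> on the right, replacing \<open>x\<^sup>4\<close> by \<open>z\<close>.\<close>

fun snoc :: "int \<Rightarrow> code \<Rightarrow> code" where
  "snoc c (k, cs) =
    (if take 3 cs = [0, 0, 0] then (k + 1, add_last c (drop 3 cs)) else (k, c # cs))"

lemma represents_snoc:
  assumes "represents w y"
  shows "represents (snoc c w) (y * hecke_x * s_pow c)"
proof -
  obtain k cs where w: "w = (k, cs)" by fastforce
  show ?thesis
  proof (cases "take 3 cs = [0, 0, 0]")
    case True
    then obtain ds where ds: "cs = [0, 0, 0] @ ds"
        by (metis append_take_drop_id)
    obtain i where "y = s_pow i * (z_pow k * word cs)"
      using assms w by (auto simp: represents_def)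
    then have "y * hecke_x = (s_pow i * (z_pow k * word ds)) * hecke_z"
      by (simp add: ds hecke_z_eq mult.assoc)
    moreover have "represents (k, ds) (s_pow i * (z_pow k * word ds))"
      by (auto simp: represents_def)
    ultimately have "represents (k + 1, ds) (y * hecke_x)"
      using represents_z(1) by simp
    then show ?thesis
      using w ds by (simp add: represents_add_last)
  next
    case False
    then show ?thesis using assms w by (auto intro: represents_Cons)
  qed
qed

text \<open>One pass from the left end of the product suffices: \<open>snoc\<close> changes only the
  exponent at the right end, and this cannot create a new \<open>x^4\<close>.\<close>

fun normal_form :: "code \<Rightarrow> code" where
  "normal_form (k, []) = (k, [])"
| "normal_form (k, c # cs) = snoc c (normal_form (k, cs))"

lemma represents_normal_form: "represents (normal_form w) (element w)"
proof -
  have "represents (normal_form (k, cs)) (element (k, cs))" for k cs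
  proof (induction cs)
    case Nil
    show ?case using represents_element[of "(k, [])"] by simp
  next
    case (Cons c cs)
    then show ?case using represents_snoc[OF Cons, of c] by (simp add: mult.assoc)
  qed
  then show ?thesis by (cases w) simp
qed

text \<open>The case of \<open>t\<close> uses \<open>t = s^-1 x\<close> and
  \<open>t^-1 = x^3 s z^-1\<close>. The result need not be reduced; that is left to
  \<open>canonical\<close>.\<close>

fun times_gen :: "gen \<Rightarrow> bool \<Rightarrow> code \<Rightarrow> code" where
  "times_gen Gen_s d (k, cs) = (k, add_last (if d then 1 else - 1) cs)"
| "times_gen Gen_t d (k, cs) = (if d then (k, 0 # add_last (- 1) cs) else (k - 1, 1 # 0 # 0 # cs))"

lemma hecke_ti_x: "hecke_ti = hecke_x * hecke_x * hecke_x * hecke_s * hecke_zi"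
proof -
  have "hecke_z * hecke_ti = hecke_x * hecke_x * hecke_x * hecke_s"
    by (simp add: hecke_z_eq hecke_x_def mult.assoc hecke_t_inverse)
  moreover have "hecke_z * hecke_ti = hecke_ti * hecke_z"
    using z_pow_commute_ti[of 1] by simp
  ultimately show ?thesis
    by (metis hecke_z_inverse(1) mult.assoc mult.right_neutral)
qed

lemma hecke_t_x: "hecke_t = hecke_si * hecke_x"
  by (simp add: hecke_x_def inverse_cancel)

lemma represents_times_gen:
  assumes "represents w y"
  shows "represents (times_gen g d w) (y * signed_gen g d)"
proof -
  obtain k cs where w: "w = (k, cs)" by fastforce
  have "represents (k, 0 # add_last (- 1) cs) (y * hecke_t)"
    using represents_Cons[OF represents_add_last[OF assms[unfolded w], of "- 1"], of 0]
    by (simp add: hecke_t_x mult.assoc)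
  moreover have "represents (k - 1, 1 # 0 # 0 # cs) (y * hecke_ti)"
    using represents_z(2)[OF represents_append[OF assms[unfolded w], of "[1, 0, 0]"]]
    by (simp add: hecke_ti_x mult.assoc)
  moreover have "represents (k, add_last 1 cs) (y * hecke_s)"
      "represents (k, add_last (- 1) cs) (y * hecke_si)"
    using represents_add_last[OF assms[unfolded w], of 1]
      represents_add_last[OF assms[unfolded w], of "- 1"] by simp_all
  ultimately show ?thesis by (cases g) (simp_all add: w)
qed

lemma represents_times_gen_power:
  "represents w y \<Longrightarrow> represents ((times_gen g d ^^ n) w) (y * signed_gen g d ^ n)"
proof (induction n)
  case (Suc n)
  then show ?case
    using represents_times_gen[of "(times_gen g d ^^ n) w" "y * signed_gen g d ^ n" g d]
    by (simp add: power_Suc2 mult.assoc del: power_Suc)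
qed simp

text \<open>
  Normal form up to powers of \<open>t\<close> on the right: \<open>x t\<^sup>-\<^sup>1 = s\<close> removes a final \<open>x\<close>, and \<open>x\<^sup>3 s t = z\<close>
  removes a final \<open>x\<^sup>3 s\<close>.
\<close>

function strip_t :: "code \<Rightarrow> code" where
  "strip_t (k, cs) =
    (if take 1 cs = [0] then strip_t (k, add_last 1 (drop 1 cs))
     else if take 3 cs = [1, 0, 0] then strip_t (k + 1, drop 3 cs)
     else (k, cs))"
  by pat_completeness auto

lemma length_add_last [simp]: "length (add_last c cs) = length cs"
  by (cases cs) simp_all

termination strip_t
proof (relation "measure (\<lambda>(k, cs). length cs)", goal_cases)
  case (2 k cs)
  then show ?case by (cases cs) simp_all
next
  case (3 k cs)
  then show ?case by (cases cs) simp_all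
qed simp

declare strip_t.simps [simp del]

lemma represents_strip_t:
  assumes "represents w y"
  obtains n where "represents (strip_t w) (y * t_pow n)"
proof -
  have "\<exists>n. represents (strip_t w) (y * t_pow n)"
    using assms
  proof (induction w arbitrary: y rule: strip_t.induct)
    case (1 k cs)
    consider (zero) "take 1 cs = [0]" | (inv) "take 1 cs \<noteq> [0]" "take 3 cs = [1, 0, 0]"
      | (stop) "take 1 cs \<noteq> [0]" "take 3 cs \<noteq> [1, 0, 0]" by blast
    then show ?case
    proof cases
      case zero
      then obtain ds where ds: "cs = [0] @ ds"
        by (metis append_take_drop_id)
      obtain i where "y = s_pow i * (z_pow k * word cs)"
        using "1.prems" by (auto simp: represents_def)
      then have "y * hecke_ti = s_pow i * (z_pow k * word ds) * s_pow 1"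
        by (simp add: ds hecke_x_def mult.assoc hecke_t_inverse)
      then have "represents (k, add_last 1 ds) (y * hecke_ti)"
        using represents_add_last[of k ds "s_pow i * (z_pow k * word ds)" 1]
        by (auto simp: represents_def)
      then have "represents (k, add_last 1 (drop 1 cs)) (y * hecke_ti)"
        using ds by simp
      from "1.IH"(1)[OF zero this]
      obtain n where n: "represents (strip_t (k, add_last 1 (drop 1 cs))) (y * hecke_ti * t_pow n)" ..
      have "hecke_ti * t_pow n = t_pow (- 1 + n)"
        unfolding t_pow_add by simp
      then show ?thesis
        using n zero by (auto simp: strip_t.simps[of k cs] mult.assoc)
    next
      case inv
      then obtain ds where ds: "cs = [1, 0, 0] @ ds"
        by (metis append_take_drop_id)
      obtain i where "y = s_pow i * (z_pow k * word cs)"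
        using "1.prems" by (auto simp: represents_def)
      then have "y * hecke_t = s_pow i * (z_pow k * word ds) * hecke_z"
        by (simp add: ds hecke_z_eq mult.assoc) (simp add: hecke_x_def)
      moreover have "represents (k, ds) (s_pow i * (z_pow k * word ds))"
        by (auto simp: represents_def)
      ultimately have "represents (k + 1, drop 3 cs) (y * hecke_t)"
        using represents_z(1) ds by simp
      from "1.IH"(2)[OF inv this]
      obtain n where n: "represents (strip_t (k + 1, drop 3 cs)) (y * hecke_t * t_pow n)" ..
      have "hecke_t * t_pow n = t_pow (1 + n)"
        unfolding t_pow_add by simp
      then show ?thesis
        using n inv by (auto simp: strip_t.simps[of k cs] mult.assoc)
    next
      case stop
      then show ?thesis
        using "1.prems" by (auto simp: strip_t.simps[of k cs] intro!: exI[of _ 0])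
    qed
  qed
  then show ?thesis using that by blast
qed

text \<open>Works modulo powers of \<open>s\<close> on the left and of \<open>t\<close> on the
  right, which is all that membership in a bistable submodule can see.\<close>

definition canonical :: "code \<Rightarrow> code" where
  "canonical w = strip_t (normal_form w)"

section \<open>Derivations along lines\<close>

text \<open>
  With \<open>p\<close> coded by \<open>(k, cs)\<close> and \<open>q = s\<^sup>c \<cdot> word ds\<close>, the step \<open>Step g d k ds c cs\<close> derives \<open>p q\<close> from
  the elements \<open>p g\<^sup>\<plusminus>\<^sup>n q\<close>, \<open>1 \<le> n \<le> gen_degree g\<close>, where the sign is \<open>+\<close> iff \<open>d\<close>.
\<close>

datatype step = Step gen bool int "int list" int "int list"

fun insert_word :: "int list \<Rightarrow> int \<Rightarrow> code \<Rightarrow> code" where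
  "insert_word ds c (k, cs) = (k, ds @ add_last c cs)"

lemma represents_insert_word:
  "represents w y \<Longrightarrow> represents (insert_word ds c w) (y * (s_pow c * word ds))"
  using represents_append[OF represents_add_last, of "fst w" "snd w" y ds c]
  by (cases w) (simp add: mult.assoc)

fun step_conclusion :: "step \<Rightarrow> code" where
  "step_conclusion (Step g d k ds c cs) = canonical (insert_word ds c (k, cs))"

fun step_premises :: "step \<Rightarrow> code list" where
  "step_premises (Step g d k ds c cs) =
    map (\<lambda>n. canonical (insert_word ds c ((times_gen g d ^^ n) (k, cs)))) [1..<Suc (gen_degree g)]"

text \<open>Premises are compared literally with \<open>ws\<close>, so its entries should be
  canonical codes; those of \<open>initial_words\<close> already are. Each conclusion joins
  \<open>ws\<close> and is available to later steps.\<close>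

fun derivable :: "code list \<Rightarrow> step list \<Rightarrow> code list \<Rightarrow> bool" where
  "derivable ws [] vs \<longleftrightarrow> list_all (\<lambda>w. canonical w \<in> set ws) vs"
| "derivable ws (st # sts) vs \<longleftrightarrow>
    list_all (\<lambda>w. w \<in> set ws) (step_premises st) \<and> derivable (step_conclusion st # ws) sts vs"

locale bistable =
  fixes V :: "hecke set"
  assumes subspace: "hecke.subspace V"
    and left_s: "y \<in> V \<Longrightarrow> hecke_s * y \<in> V"
    and right_t: "y \<in> V \<Longrightarrow> y * hecke_t \<in> V"
begin

lemma left_si: "y \<in> V \<Longrightarrow> hecke_si * y \<in> V"
proof -
  assume y: "y \<in> V"
  obtain a b where "hecke_si = a \<cdot> 1 - b \<cdot> hecke_s" by (rule hecke_si_eq)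
  then show ?thesis
    using y by (auto simp: left_diff_distrib hecke_scale_mult intro!: left_s
        hecke.subspace_diff[OF subspace] hecke.subspace_scale[OF subspace])
qed

lemma right_ti: "y \<in> V \<Longrightarrow> y * hecke_ti \<in> V"
proof -
  assume y: "y \<in> V"
  obtain a b c where ti: "hecke_ti = a \<cdot> 1 - b \<cdot> hecke_t + c \<cdot> (hecke_t * hecke_t)" by (rule hecke_ti_eq)
  have "y * (hecke_t * hecke_t) \<in> V"
    using right_t[OF right_t[OF y]] by (simp add: mult.assoc)
  then show ?thesis
    using y by (auto simp: ti distrib_left right_diff_distrib hecke_scale_mult intro!: right_t
        hecke.subspace_diff[OF subspace] hecke.subspace_scale[OF subspace]
        hecke.subspace_add[OF subspace])
qed

lemma left_s_pow: "y \<in> V \<Longrightarrow> s_pow n * y \<in> V"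
proof -
  assume y: "y \<in> V"
  have "hecke_s ^ m * y \<in> V \<and> hecke_si ^ m * y \<in> V" for m
    by (induction m) (auto simp: y left_s left_si mult.assoc)
  then show ?thesis by (simp add: int_power_def)
qed

lemma right_t_pow: "y \<in> V \<Longrightarrow> y * t_pow n \<in> V"
proof -
  assume y: "y \<in> V"
  have "y * hecke_t ^ m \<in> V \<and> y * hecke_ti ^ m \<in> V" for m
    by (induction m) (auto simp: y right_t right_ti power_Suc2 simp del: power_Suc simp flip: mult.assoc)
  then show ?thesis by (simp add: int_power_def)
qed

lemma represents_mem:
  assumes "represents w y"
  shows "y \<in> V \<longleftrightarrow> element w \<in> V"
proof -
  obtain i where i: "y = s_pow i * element w" using assms by (auto simp: represents_def)
  have "s_pow (- i) * y = element w"
    by (simp add: i flip: s_pow_add mult.assoc)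
  then show ?thesis using left_s_pow[of y "- i"] left_s_pow[of "element w" i] i by auto
qed

text \<open>The powers of \<open>s\<close> and \<open>t\<close> by which the two elements differ act
  invertibly on \<open>V\<close>.\<close>

lemma canonical_mem: "element (canonical w) \<in> V \<longleftrightarrow> element w \<in> V"
proof -
  have "represents (normal_form w) (element w)" by (rule represents_normal_form)
  then obtain n where n: "represents (canonical w) (element w * t_pow n)"
    unfolding canonical_def by (rule represents_strip_t)
  have "element w * t_pow n * t_pow (- n) = element w"
    by (simp add: mult.assoc flip: t_pow_add)
  then show ?thesis
    using represents_mem[OF n] right_t_pow[of "element w" n] right_t_pow[of "element w * t_pow n" "- n"]
    by auto
qed

text \<open>The elements \<open>y\<close> with \<open>p * y * q\<close> in \<open>V\<close> form a
  submodule. It contains the listed powers, hence 1 by \<open>one_in_span_powers\<close>.\<close>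

lemma line:
  assumes "\<And>n. n \<in> {1..gen_degree g} \<Longrightarrow> p * signed_gen g d ^ n * q \<in> V"
  shows "p * q \<in> V"
proof -
  have "hecke.subspace {y. p * y * q \<in> V}"
    using hecke.subspace_0[OF subspace] hecke.subspace_add[OF subspace] hecke.subspace_scale[OF subspace]
    by (auto simp: hecke.subspace_def distrib_left distrib_right hecke_scale_mult)
  then have "hecke.span ((\<lambda>n. signed_gen g d ^ n) ` {1..gen_degree g}) \<subseteq> {y. p * y * q \<in> V}"
    using assms by (intro hecke.span_minimal) auto
  then show ?thesis using one_in_span_powers[of g d] by auto
qed

lemma step_sound:
  assumes "\<And>w. w \<in> set (step_premises st) \<Longrightarrow> element w \<in> V"
  shows "element (step_conclusion st) \<in> V"
proof (cases st)
  case st: (Step g d k ds c cs)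
  define y where "y = element (k, cs)"
  have rep: "represents (insert_word ds c ((times_gen g d ^^ n) (k, cs)))
      (y * signed_gen g d ^ n * (s_pow c * word ds))" for n
    unfolding y_def
    by (intro represents_insert_word represents_times_gen_power represents_element)
  have "y * (s_pow c * word ds) \<in> V"
  proof (rule line)
    fix n assume "n \<in> {1..gen_degree g}"
    then have "element (canonical (insert_word ds c ((times_gen g d ^^ n) (k, cs)))) \<in> V"
      by (intro assms) (simp add: st del: upt_Suc)
    then show "y * signed_gen g d ^ n * (s_pow c * word ds) \<in> V"
      unfolding canonical_mem by (simp only: represents_mem[OF rep])
  qed
  then show ?thesis
    \<comment> \<open>The exponent 0 gives the conclusion \<open>p q\<close> itself.\<close>
    using rep[of 0] by (simp add: st canonical_mem represents_mem)
qed

lemma derivable_sound: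
  assumes "derivable ws sts vs" "\<And>w. w \<in> set ws \<Longrightarrow> element w \<in> V" "v \<in> set vs"
  shows "element v \<in> V"
  using assms
proof (induction sts arbitrary: ws)
  case Nil
  then have "element (canonical v) \<in> V"
    by (auto simp: list_all_iff simp del: element.simps)
  then show ?case by (simp only: canonical_mem)
next
  case (Cons st sts)
  then have prems: "\<And>w. w \<in> set (step_premises st) \<Longrightarrow> element w \<in> V"
    and rest: "derivable (step_conclusion st # ws) sts vs"
    by (auto simp: list_all_iff simp del: element.simps)
  from step_sound[OF prems] have "element (step_conclusion st) \<in> V" .
  with Cons.prems show ?case
    by (intro Cons.IH[OF rest]) (auto simp del: element.simps)
qed

end

text \<open>
  Each list below derives the named word times \<open>z\<^sup>k\<close> (with \<open>i\<close> marking an inverse, so that \<open>tists\<close> is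
  \<open>t\<^sup>-\<^sup>1sts\<close>). The lists other than \<open>top\<close> and \<open>bottom\<close> are for \<open>k = 0\<close> up to a shift; because all
  powers of \<open>z\<close> must stay in range, the generic derivations fail for \<open>tists\<close> at \<open>k = 5\<close> and for
  \<open>tistis\<close> at \<open>k = 0\<close>, and those two need longer ones.
\<close>

definition steps_tists :: "step list" where
  "steps_tists = [
    Step Gen_s True 0 [] 2 [- 2, 0, 0, 1],
    Step Gen_s True 0 [0, 0, 0] 0 [- 1],
    Step Gen_s True 0 [] 2 [- 2, 0, 0],
    Step Gen_t True (- 1) [0, 0] 0 [1, 0, 0]]"

definition steps_tistis :: "step list" where
  "steps_tistis = [
    Step Gen_t True (- 2) [2, 0, 0, 1, 0, 0] 0 [],
    Step Gen_s False (- 1) [] 0 [2, 0],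
    Step Gen_s False (- 2) [2, 0, 0] 0 [2, 0, 0]]"

definition steps_tists_top :: "step list" where
  "steps_tists_top = [
    Step Gen_s False 0 [0] 0 [1],
    Step Gen_t False (- 2) [2, 0, 0, 1, 0, 0] 0 [0, - 1, - 1, - 1, 0],
    Step Gen_s False 0 [0, 0] 0 [1, 0],
    Step Gen_s True 0 [] 1 [- 1, 0, 0, 1, 0, 0],
    Step Gen_s True 0 [0, 0, 0] 0 [- 1, 0, 0],
    Step Gen_t False 0 [0, 0] 0 [0, - 1, - 1, 0, 0],
    Step Gen_s False 0 [0, 0, 0, - 1] 0 [1, 0, 0],
    Step Gen_s False 0 [0, 0, 0] (- 1) [2, 1, 0, 0],
    Step Gen_s False 0 [] 0 [2, 0, 0, 1, 1, 0, 0],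
    Step Gen_s False 0 [1, 0, 0] 0 [2, 1, 0, 0],
    Step Gen_s True 1 [] 1 [- 1, 0, 0, 1, 0, 0],
    Step Gen_t False 1 [0] 0 [0, - 1, 0, 1, 0, 0],
    Step Gen_s False 1 [0, 0] (- 1) [2, 0, 1, 0, 0],
    Step Gen_s False 2 [0] 0 [1],
    Step Gen_t False 0 [2, 0, 0, 1, 0, 0] 0 [0, - 1, - 1, - 1, 0],
    Step Gen_s False 2 [0, 0] 0 [1, 0],
    Step Gen_t False 2 [0, 0, 1, 0] 0 [0, - 1],
    Step Gen_s False 2 [0, 0, 1, 0, 0] 0 [1],
    Step Gen_t False 2 [2, 0, 0] 0 [0, - 1, - 1],
    Step Gen_s False 3 [0, 0] 0 [1],
    Step Gen_t False 3 [0, 0] 0 [0, - 1, 0],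
    Step Gen_s False 3 [0, 0, 0] 0 [1, 0],
    Step Gen_s False 3 [] 0 [2, 0, 0, 1, 0],
    Step Gen_t False 4 [0] 0 [0, - 1, 0, 0],
    Step Gen_s False 4 [0, 0] (- 1) [2, 0, 0]]"

definition steps_tistis_bottom :: "step list" where
  "steps_tistis_bottom = [
    Step Gen_s False (- 1) [] 2 [1, 0, 0],
    Step Gen_t False (- 1) [3, 0, 0] 0 [0, - 1, - 1],
    Step Gen_s False 0 [0, 0, 0] 0 [2, 0, 0],
    Step Gen_t False 0 [0, 0, 0, 2, 0, 0] 0 [0, - 1, - 1],
    Step Gen_s True 2 [0, 0] 1 [- 2, 0, 0],
    Step Gen_t True 1 [0] 0 [1, 0, 0, 1, 0],
    Step Gen_s True 1 [] 1 [- 1, 0, 0, 1, 0],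
    Step Gen_s False 1 [0, 0, 0, 1] 0 [1],
    Step Gen_s True 3 [0, 0] 1 [- 2, 0, 0],
    Step Gen_t True 2 [0] 0 [1, 0, 0, 1, 0],
    Step Gen_s True 2 [] 0 [0, 0, 0, 1, 0],
    Step Gen_s True 2 [] 0 [- 1, 0, 0, 1, 0],
    Step Gen_s True 3 [] 0 [- 1, 0],
    Step Gen_t False 2 [0, 0, 0] 0 [0, - 1, - 1, 0],
    Step Gen_s True 3 [0] 0 [- 2, 0, 0],
    Step Gen_s False 3 [- 1] 0 [1, 0],
    Step Gen_s True 3 [] 1 [- 1, 0, 0, 1, 0, 0],
    Step Gen_s True 3 [0, 0, 0] 0 [- 1, 0, 0],
    Step Gen_s True 3 [0] 0 [- 2, 0, - 1, 0, 0],
    Step Gen_t True 2 [- 1] 0 [1, 0, 0, 1, 0],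
    Step Gen_s True 2 [- 1] 0 [- 1, 0, 0, 1, 0],
    Step Gen_t True 1 [0, 0, 0] 0 [1, 0, 1, 0],
    Step Gen_s True 1 [0, 0, 0, 1, 0] 1 [- 2, 0],
    Step Gen_t True 0 [0, 0, 0, 1] 0 [1, 0, 0, 1],
    Step Gen_s True 0 [0, 0, 0] 1 [- 2, 1, 0, 0, 1],
    Step Gen_s True 0 [0, 0, 0, - 1] 1 [- 2, 0, 0, 1],
    Step Gen_s True 0 [0, 0, 0, - 1, - 1, 0, 0] 1 [- 2],
    Step Gen_s True 2 [] 0 [- 1, 0],
    Step Gen_t True 0 [0, 0, 0] 0 [1, 0, 0, 1],
    Step Gen_s True 0 [0, 0, 0, 1, 0, 0] 1 [- 2],
    Step Gen_t False 0 [2, 0, 0] 0 [0, - 1, - 1],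
    Step Gen_s True 0 [0, 0, 0] 0 [- 1, 0, 0, - 1],
    Step Gen_t True 0 [0, 0] 0 [1, 0, - 1],
    Step Gen_s True 1 [0] 0 [- 2],
    Step Gen_s True 0 [0, 0] 0 [- 1, 0, - 1],
    Step Gen_t True (- 1) [2, 0, 0] 0 [1, - 1],
    Step Gen_t True (- 2) [2, 0, 0] 1 [1, 0, 0]]"

definition steps_tiststis_low :: "step list" where
  "steps_tiststis_low = [
    Step Gen_s False (- 2) [1, 0, 0] 0 [2, 1, 0, 0],
    Step Gen_t False 0 [2, 0, 0] 0 [0, - 1, - 1],
    Step Gen_s False 1 [0, 0] 0 [1],
    Step Gen_s True 2 [0, 0] 1 [- 2, 0, 0],
    Step Gen_t True 1 [0] 0 [1, 0, 0, 1, 0],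
    Step Gen_s True 1 [] 1 [- 1, 0, 0, 1, 0],
    Step Gen_s True 1 [0, 0, 0] 0 [- 1, 0],
    Step Gen_t True 0 [0, 0] 0 [1, 0, 0, 1],
    Step Gen_s True 0 [0, 0, 1, 0, 0] 1 [- 2],
    Step Gen_s True 0 [0, 0] 0 [- 1, 0, 0, - 1],
    Step Gen_s False 0 [0] 0 [1],
    Step Gen_t False (- 2) [2, 0, 0, 1, 0, 0] 0 [0, - 1, - 1, - 1, 0],
    Step Gen_s True 0 [0, 0] 1 [- 2, 0, 0],
    Step Gen_t True (- 1) [0, 0, - 1, 0] 0 [1, 0, 0],
    Step Gen_s True (- 1) [] 1 [- 1, 0, 0, 1, 0, 0],
    Step Gen_t True (- 2) [0] 0 [1, 0, 0, 1, 1, 0, 0]]"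

definition steps_tiststis_high :: "step list" where
  "steps_tiststis_high = [
    Step Gen_s False (- 2) [0] 0 [1],
    Step Gen_t False (- 4) [2, 0, 0, 1, 0, 0] 0 [0, - 1, - 1, - 1, 0],
    Step Gen_s False (- 2) [0, 0] 0 [1, 0],
    Step Gen_s True (- 2) [] 1 [- 1, 0, 0, 1, 0, 0],
    Step Gen_s True (- 2) [0, 0, 0] 0 [- 1, 0, 0],
    Step Gen_t False (- 2) [0, 0] 0 [0, - 1, - 1, 0, 0],
    Step Gen_s False (- 2) [0, 0, 0, - 1] 0 [1, 0, 0],
    Step Gen_s False (- 2) [0, 0, 0] (- 1) [2, 1, 0, 0],
    Step Gen_s False (- 2) [] 0 [2, 0, 0, 1, 1, 0, 0]]"

definition steps_titis :: "step list" where
  "steps_titis = [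
    Step Gen_t True (- 2) [] 1 [1, 0, 0, 1, 0, 0]]"

fun shift :: "int \<Rightarrow> step \<Rightarrow> step" where
  "shift i (Step g d k ds c cs) = Step g d (i + k) ds c cs"

text \<open>In order these encode \<open>1\<close>, \<open>ts\<close>, \<open>t^-1 s\<close> and
  \<open>t s t^-1 s\<close> times \<open>z^k\<close>, up to a left power of \<open>s\<close>. Each
  \<open>t^-1\<close> costs a factor \<open>z^-1\<close>, as \<open>x^3 s = z t^-1\<close>.\<close>

definition initial_words :: "int \<Rightarrow> code list" where
  "initial_words k = [(k, []), (k, [1]), (k - 1, [2, 0, 0]), (k - 1, [2, 0, 0, 1])]"

text \<open>In order these encode \<open>t^-1 s t s\<close>, \<open>t^-2 s\<close>,
  \<open>t^-1 s t^-1 s\<close> and \<open>t^-1 s t s t^-1 s\<close> times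
  \<open>z^k\<close>.\<close>

definition final_words :: "int \<Rightarrow> code list" where
  "final_words k =
    [(k - 1, [1, 1, 0, 0]), (k - 2, [2, 0, 0, 1, 0, 0]), (k - 2, [2, 0, 0, 2, 0, 0]),
     (k - 2, [2, 0, 0, 1, 1, 0, 0])]"

text \<open>The order matters: \<open>steps_tists_top\<close>, for example, reuses the code
  \<open>(0, [1, 0])\<close> of \<open>ststs\<close>, derived by the generic list for
  \<open>tists\<close>. The list \<open>steps_tiststis_high\<close> uses words with factor
  \<open>z^(k-2)\<close>, so it serves only \<open>k \<ge> 2\<close>.\<close>

definition all_steps :: "step list" where
  "all_steps =
    concat (map (\<lambda>k. map (shift k) steps_tists) [0..4]) @
    concat (map (\<lambda>k. map (shift k) steps_tistis) [1..5]) @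
    steps_tists_top @ steps_tistis_bottom @
    concat (map (\<lambda>k. map (shift k) steps_tiststis_low) [0..1]) @
    concat (map (\<lambda>k. map (shift k) steps_tiststis_high) [2..5]) @
    concat (map (\<lambda>k. map (shift k) steps_titis) [0..5])"

text \<open>All 24 goals are checked in one run, because the derivations for different powers of
  \<open>z\<close> share intermediate codes.\<close>

lemma derivable_final_words:
  "derivable (concat (map initial_words [0..5])) all_steps (concat (map final_words [0..5]))"
  by code_simp

section \<open>The span of the 144 generators\<close>

definition middle_factors :: "hecke set" where
  "middle_factors = {1, hecke_t * hecke_s, hecke_ti * hecke_s, hecke_t * hecke_s * hecke_ti * hecke_s}"

definition hecke_gens :: "hecke set" where
  "hecke_gens = {hecke_z ^ k * u * w * v | k u w v.
     k \<le> 5 \<and> u \<in> {1, hecke_s} \<and> w \<in> middle_factors \<and> v \<in> {1, hecke_t, hecke_ti}}"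

lemma hecke_gensI:
  assumes "k \<le> 5" "u \<in> {1, hecke_s}" "w \<in> middle_factors" "v \<in> {1, hecke_t, hecke_ti}"
  shows "hecke_z ^ k * u * w * v \<in> hecke.span hecke_gens"
  using assms unfolding hecke_gens_def by (intro hecke.span_base) blast

lemma hecke_gensE:
  assumes "y \<in> hecke_gens"
  obtains k u w v where "y = hecke_z ^ k * u * w * v" "k \<le> 5" "u \<in> {1, hecke_s}"
    "w \<in> middle_factors" "v \<in> {1, hecke_t, hecke_ti}"
  using assms unfolding hecke_gens_def mem_Collect_eq by (elim exE conjE)

section \<open>Stability of the span under \<open>s\<close> on the left and \<open>t\<close> on the
  right\<close>

lemma span_mult_left:
  assumes "\<And>y. y \<in> S \<Longrightarrow> a * y \<in> hecke.span T" "y \<in> hecke.span S"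
  shows "a * y \<in> hecke.span T"
  using assms(2)
proof (induction rule: hecke.span_induct_alt)
  case base
  show ?case by (simp add: hecke.span_zero)
next
  case (step c x y)
  then show ?case
    using assms(1)
    by (simp add: distrib_left hecke_scale_mult hecke.span_add hecke.span_scale)
qed

lemma span_mult_right:
  assumes "\<And>y. y \<in> S \<Longrightarrow> y * a \<in> hecke.span T" "y \<in> hecke.span S"
  shows "y * a \<in> hecke.span T"
  using assms(2)
proof (induction rule: hecke.span_induct_alt)
  case base
  show ?case by (simp add: hecke.span_zero)
next
  case (step c x y)
  then show ?case
    using assms(1)
    by (simp add: distrib_right hecke_scale_mult hecke.span_add hecke.span_scale)
qed

lemma hecke_z_power_commute: "y * hecke_z = hecke_z * y \<Longrightarrow> y * (hecke_z ^ k * x) = hecke_z ^ k * (y * x)"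
  by (metis mult.assoc power_commuting_commutes)

text \<open>Since \<open>z\<close> is central, only the outer factors \<open>u\<close> and
  \<open>v\<close> change. They are brought back into range by the quadratic and the cubic
  relation.\<close>

interpretation gens: bistable "hecke.span hecke_gens"
proof
  show "hecke.subspace (hecke.span hecke_gens)"
    by (rule hecke.subspace_span)
next
  fix y
  assume "y \<in> hecke.span hecke_gens"
  then show "hecke_s * y \<in> hecke.span hecke_gens"
  proof (rule span_mult_left[rotated])
    fix y
    assume "y \<in> hecke_gens"
    then obtain k u w v where y: "y = hecke_z ^ k * u * w * v" "k \<le> 5" "u \<in> {1, hecke_s}"
        "w \<in> middle_factors" "v \<in> {1, hecke_t, hecke_ti}"
      by (rule hecke_gensE)
    obtain a b b' where s: "hecke_s * hecke_s = a \<cdot> hecke_s - b \<cdot> 1"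
      by (rule hecke_s_quadratic)
    have s_y: "hecke_s * y = hecke_z ^ k * (hecke_s * u) * w * v"
      by (simp add: y(1) hecke_z_power_commute hecke_z_commute mult.assoc)
    have m: "hecke_z ^ k * 1 * w * v \<in> hecke.span hecke_gens"
        "hecke_z ^ k * hecke_s * w * v \<in> hecke.span hecke_gens"
      by (intro hecke_gensI y; simp)+
    show "hecke_s * y \<in> hecke.span hecke_gens"
    proof (cases "u = 1")
      case True
      then show ?thesis using m(2) by (simp add: s_y)
    next
      case False
      then have "hecke_s * y = a \<cdot> (hecke_z ^ k * hecke_s * w * v) - b \<cdot> (hecke_z ^ k * 1 * w * v)"
        using y(3) by (simp add: s_y s left_diff_distrib right_diff_distrib hecke_scale_mult)
      then show ?thesis using m by (simp add: hecke.span_diff hecke.span_scale)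
    qed
  qed
next
  fix y
  assume "y \<in> hecke.span hecke_gens"
  then show "y * hecke_t \<in> hecke.span hecke_gens"
  proof (rule span_mult_right[rotated])
    fix y
    assume "y \<in> hecke_gens"
    then obtain k u w v where y: "y = hecke_z ^ k * u * w * v" "k \<le> 5" "u \<in> {1, hecke_s}"
        "w \<in> middle_factors" "v \<in> {1, hecke_t, hecke_ti}"
      by (rule hecke_gensE)
    obtain a b c c' where
      "hecke_t * hecke_t * hecke_t = a \<cdot> (hecke_t * hecke_t) - b \<cdot> hecke_t + c \<cdot> 1"
      by (rule hecke_t_cubic)
    \<comment> \<open>Dividing by \<open>t\<close> expresses \<open>t^2\<close> through
      \<open>t\<close>, \<open>1\<close> and \<open>t^-1\<close>, the values allowed for
      \<open>v\<close>.\<close>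
    from arg_cong[OF this, of "\<lambda>y. y * hecke_ti"]
    have t: "hecke_t * hecke_t = a \<cdot> hecke_t - b \<cdot> 1 + c \<cdot> hecke_ti"
      by (simp add: left_diff_distrib distrib_right hecke_scale_mult mult.assoc hecke_t_inverse)
    define p where "p = hecke_z ^ k * u * w"
    have p: "p * v \<in> hecke.span hecke_gens" if "v \<in> {1, hecke_t, hecke_ti}" for v
      unfolding p_def by (rule hecke_gensI[OF y(2-4) that])
    have "p * (v * hecke_t) \<in> hecke.span hecke_gens"
    proof (cases "v = hecke_t")
      case True
      then have "p * (v * hecke_t) = a \<cdot> (p * hecke_t) - b \<cdot> (p * 1) + c \<cdot> (p * hecke_ti)"
        by (simp add: t distrib_left right_diff_distrib hecke_scale_mult)
      also have "\<dots> \<in> hecke.span hecke_gens"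
        by (intro hecke.span_add hecke.span_diff hecke.span_scale p) simp_all
      finally show ?thesis .
    next
      case False
      then show ?thesis
        using y(5) p[of 1] p[of hecke_t] by (auto simp: hecke_t_inverse)
    qed
    then show "y * hecke_t \<in> hecke.span hecke_gens"
      by (simp add: y(1) p_def mult.assoc)
  qed
qed

text \<open>Decodes an entry pattern \<open>c, 0, 0\<close> as an inverse of \<open>t\<close>, by
  \<open>x^3 s^c = z t^-1 s^(c-1)\<close>.\<close>

lemma word_ti:
  "z_pow (k - 1) * word (c # 0 # 0 # cs) = z_pow k * word cs * hecke_ti * s_pow (c - 1)"
proof -
  have "z_pow (k - 1) = z_pow k * hecke_zi"
    using z_pow_add[of k "- 1"] by simp
  moreover have "word cs * hecke_zi = hecke_zi * word cs"
    by (intro commute_inverse[OF hecke_z_inverse] word_commute_z)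
  moreover have "hecke_ti = hecke_zi * hecke_x * hecke_x * hecke_x * hecke_s"
  proof -
    have "hecke_zi * (hecke_z * hecke_ti) = hecke_zi * (hecke_x * hecke_x * hecke_x * hecke_s)"
      by (simp add: hecke_z_eq hecke_x_def mult.assoc hecke_t_inverse)
    then show ?thesis
      by (simp add: hecke_z_inverse flip: mult.assoc)
  qed
  moreover have "hecke_s * s_pow (c - 1) = s_pow c"
    using s_pow_add[of 1 "c - 1"] by simp
  ultimately show ?thesis
    by (simp add: mult.assoc) (metis mult.assoc)
qed

lemma initial_words_mem:
  assumes "k \<in> set [0..5]" "w \<in> set (initial_words k)"
  shows "element w \<in> hecke.span hecke_gens"
proof -
  define n where "n = nat k"
  have n: "n \<le> 5" "k = int n" using assms by (auto simp: n_def)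
  have "element (k, []) \<in> hecke.span hecke_gens"
    using hecke_gensI[OF n(1), of 1 1 1] by (simp add: n(2) middle_factors_def)
  moreover have "element (k, [1]) \<in> hecke.span hecke_gens"
    using hecke_gensI[OF n(1), of hecke_s "hecke_t * hecke_s" 1]
    by (simp add: n(2) hecke_x_def mult.assoc middle_factors_def)
  moreover have "element (k - 1, [2, 0, 0]) \<in> hecke.span hecke_gens"
    unfolding element.simps word_ti
    using hecke_gensI[OF n(1), of 1 "hecke_ti * hecke_s" 1]
    by (simp add: n(2) mult.assoc middle_factors_def)
  moreover have "element (k - 1, [2, 0, 0, 1]) \<in> hecke.span hecke_gens"
    unfolding element.simps word_ti
    using hecke_gensI[OF n(1), of hecke_s "hecke_t * hecke_s * hecke_ti * hecke_s" 1]
    by (simp add: n(2) hecke_x_def mult.assoc middle_factors_def)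
  ultimately show ?thesis
    using assms(2) by (auto simp: initial_words_def simp del: element.simps)
qed

lemma final_words_mem:
  assumes "k \<in> set [0..5]" "w \<in> set (final_words k)"
  shows "element w \<in> hecke.span hecke_gens"
proof (rule gens.derivable_sound[OF derivable_final_words])
  show "element v \<in> hecke.span hecke_gens" if "v \<in> set (concat (map initial_words [0..5]))" for v
    using that by (auto intro: initial_words_mem simp del: element.simps)
  show "w \<in> set (concat (map final_words [0..5]))"
    using assms by auto
qed

lemma hecke_ti_gens:
  assumes "k \<le> 5"
  shows "hecke_z ^ k * (hecke_ti * hecke_s * hecke_t * hecke_s) \<in> hecke.span hecke_gens"
    "hecke_z ^ k * (hecke_ti * hecke_ti * hecke_s) \<in> hecke.span hecke_gens"
    "hecke_z ^ k * (hecke_ti * hecke_s * hecke_ti * hecke_s) \<in> hecke.span hecke_gens"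
    "hecke_z ^ k * (hecke_ti * hecke_s * hecke_t * hecke_s * hecke_ti * hecke_s)
      \<in> hecke.span hecke_gens"
proof -
  have k: "int k \<in> set [0..5]" using assms by simp
  have *: "z_pow (int k - 1) * (word [1, 0, 0] * y) = hecke_z ^ k * (hecke_ti * y)"
      "z_pow (int k - 1) * (word [2, 0, 0] * y) = hecke_z ^ k * (hecke_ti * (hecke_s * y))" for y
    using word_ti[of "int k" 1 "[]"] word_ti[of "int k" 2 "[]"]
    by (simp_all flip: mult.assoc)
  have "element (int k - 1, [1, 1, 0, 0]) = hecke_z ^ k * (hecke_ti * hecke_s * hecke_t * hecke_s)"
    using *(1)[of "hecke_x * hecke_s"] by (simp add: hecke_x_def mult.assoc)
  then show "hecke_z ^ k * (hecke_ti * hecke_s * hecke_t * hecke_s) \<in> hecke.span hecke_gens"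
    using final_words_mem[OF k, of "(int k - 1, [1, 1, 0, 0])"] by (simp add: final_words_def)
  \<comment> \<open>This form matches the left side of \<open>word_ti\<close> at level
    \<open>int k - 1\<close>; a second inverse of \<open>t\<close> is then decoded by
    \<open>*\<close>.\<close>
  have 2: "int k - 2 = int k - 1 - 1" by simp
  have "element (int k - 2, [2, 0, 0, 1, 0, 0]) = hecke_z ^ k * (hecke_ti * hecke_ti * hecke_s)"
    unfolding element.simps 2 word_ti[of "int k - 1"] using *(1)[of "hecke_ti * hecke_s"]
    by (simp add: mult.assoc)
  then show "hecke_z ^ k * (hecke_ti * hecke_ti * hecke_s) \<in> hecke.span hecke_gens"
    using final_words_mem[OF k, of "(int k - 2, [2, 0, 0, 1, 0, 0])"] by (simp add: final_words_def)
  have "element (int k - 2, [2, 0, 0, 2, 0, 0]) =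
      hecke_z ^ k * (hecke_ti * hecke_s * hecke_ti * hecke_s)"
    unfolding element.simps 2 word_ti[of "int k - 1"] using *(2)[of "hecke_ti * hecke_s"]
    by (simp add: mult.assoc)
  then show "hecke_z ^ k * (hecke_ti * hecke_s * hecke_ti * hecke_s) \<in> hecke.span hecke_gens"
    using final_words_mem[OF k, of "(int k - 2, [2, 0, 0, 2, 0, 0])"] by (simp add: final_words_def)
  have "element (int k - 2, [2, 0, 0, 1, 1, 0, 0]) =
      hecke_z ^ k * (hecke_ti * hecke_s * hecke_t * hecke_s * hecke_ti * hecke_s)"
    unfolding element.simps 2 word_ti[of "int k - 1"]
    using *(1)[of "hecke_x * (hecke_s * (hecke_ti * hecke_s))"]
    by (simp add: hecke_x_def mult.assoc)
  then show "hecke_z ^ k * (hecke_ti * hecke_s * hecke_t * hecke_s * hecke_ti * hecke_s)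
      \<in> hecke.span hecke_gens"
    using final_words_mem[OF k, of "(int k - 2, [2, 0, 0, 1, 1, 0, 0])"] by (simp add: final_words_def)
qed

lemma gens_left_ti:
  assumes "y \<in> hecke.span hecke_gens"
  shows "hecke_ti * y \<in> hecke.span hecke_gens"
  using assms
proof (rule span_mult_left[rotated])
  fix y
  assume "y \<in> hecke_gens"
  then obtain k u w v where y: "y = hecke_z ^ k * u * w * v" "k \<le> 5" "u \<in> {1, hecke_s}"
      "w \<in> middle_factors" "v \<in> {1, hecke_t, hecke_ti}"
    by (rule hecke_gensE)
  have "hecke_ti * hecke_z = hecke_z * hecke_ti"
    using z_pow_commute_ti[of 1] by simp
  then have ti_y: "hecke_ti * y = hecke_z ^ k * (hecke_ti * u * w) * v"
    by (simp add: y(1) hecke_z_power_commute mult.assoc)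
  \<comment> \<open>Of the eight products \<open>t^-1 u w\<close>, these four are generators after
    cancelling \<open>t^-1 t\<close>. The other four are the families of
    \<open>hecke_ti_gens\<close>.\<close>
  have "hecke_z ^ k * hecke_ti \<in> hecke.span hecke_gens"
      "hecke_z ^ k * hecke_s \<in> hecke.span hecke_gens"
      "hecke_z ^ k * (hecke_s * (hecke_ti * hecke_s)) \<in> hecke.span hecke_gens"
      "hecke_z ^ k * (hecke_ti * hecke_s) \<in> hecke.span hecke_gens"
    using hecke_gensI[OF y(2), of 1 1 hecke_ti] hecke_gensI[OF y(2), of hecke_s 1 1]
      hecke_gensI[OF y(2), of hecke_s "hecke_ti * hecke_s" 1]
      hecke_gensI[OF y(2), of 1 "hecke_ti * hecke_s" 1]
    by (simp_all add: mult.assoc middle_factors_def)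
  then have "hecke_z ^ k * (hecke_ti * u * w) \<in> hecke.span hecke_gens"
    using y(3,4) hecke_ti_gens[OF y(2)] by (auto simp: mult.assoc inverse_cancel middle_factors_def)
  then show "hecke_ti * y \<in> hecke.span hecke_gens"
    using y(5) gens.right_t gens.right_ti by (auto simp: ti_y)
qed

lemma gens_left_t:
  assumes "y \<in> hecke.span hecke_gens"
  shows "hecke_t * y \<in> hecke.span hecke_gens"
proof -
  obtain a b c where t: "hecke_t = a \<cdot> 1 - b \<cdot> hecke_ti + c \<cdot> (hecke_ti * hecke_ti)"
    by (rule hecke_t_eq)
  have "hecke_t * y = a \<cdot> y - b \<cdot> (hecke_ti * y) + c \<cdot> (hecke_ti * (hecke_ti * y))"
    by (subst t) (simp add: left_diff_distrib distrib_right hecke_scale_mult mult.assoc)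
  then show ?thesis
    using assms by (auto intro!: hecke.span_add hecke.span_diff hecke.span_scale gens_left_ti)
qed

text \<open>Building a word letter by letter from its right end keeps it in \<open>V\<close>, and
  scalar multiples of words generate the free algebra additively.\<close>

lemma left_ideal_eq_UNIV:
  assumes V: "hecke.subspace V" and one: "1 \<in> V"
    and s: "\<And>y. y \<in> V \<Longrightarrow> hecke_s * y \<in> V" and t: "\<And>y. y \<in> V \<Longrightarrow> hecke_t * y \<in> V"
  shows "V = UNIV"
proof -
  have "abs_hecke (Poly_Mapping.single (Word gs) r) \<in> V" for gs r
  proof (induction gs)
    case Nil
    have "abs_hecke (Poly_Mapping.single (Word []) r) = r \<cdot> 1"
      using hecke_scalar[of r] by (simp add: free_scalar_def zero_gen_word_def)
    then show ?case using hecke.subspace_scale[OF V one] by simp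
  next
    case (Cons g gs)
    have "Poly_Mapping.single (Word (g # gs)) r = free_gen g * Poly_Mapping.single (Word gs) r"
      by (simp add: free_gen_def mult_single plus_gen_word_def)
    then have "abs_hecke (Poly_Mapping.single (Word (g # gs)) r) =
        (case g of Gen_s \<Rightarrow> hecke_s | Gen_t \<Rightarrow> hecke_t) * abs_hecke (Poly_Mapping.single (Word gs) r)"
      by (simp add: hecke_s_def hecke_t_def times_hecke.abs_eq split: gen.split)
    then show ?case using Cons s t by (simp split: gen.split)
  qed
  then have *: "abs_hecke (Poly_Mapping.single w r) \<in> V" for w r
    by (cases w) simp
  have "abs_hecke f \<in> V" for f
  proof (induction f rule: free_alg_induct)
    case zero
    show ?case using hecke.subspace_0[OF V] by (simp add: zero_hecke_def)
  next
    case (add f g)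
    then show ?case using hecke.subspace_add[OF V] by (simp flip: plus_hecke.abs_eq)
  qed (rule *)
  then have "y \<in> V" for y
    by (induction y rule: hecke.abs_induct)
  then show ?thesis by blast
qed

lemma span_gens_eq_UNIV: "hecke.span hecke_gens = UNIV"
  using hecke_gensI[of 0 1 1 1]
  by (intro left_ideal_eq_UNIV gens.left_s gens_left_t hecke.subspace_span)
     (simp_all add: middle_factors_def)

section \<open>Minkowski sums of submodules and the comparison with \<open>hecke_U\<close>\<close>

lemma subspace_set_plus:
  assumes "hecke.subspace A" "hecke.subspace B"
  shows "hecke.subspace (A + B)"
proof (rule hecke.subspaceI)
  show "0 \<in> A + B"
    using set_plus_intro[OF hecke.subspace_0[OF assms(1)] hecke.subspace_0[OF assms(2)]] by simp
next
  fix x y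
  assume "x \<in> A + B" "y \<in> A + B"
  then obtain a b a' b' where "a \<in> A" "b \<in> B" "x = a + b" "a' \<in> A" "b' \<in> B" "y = a' + b'"
    by (auto elim!: set_plus_elim)
  then show "x + y \<in> A + B"
    using set_plus_intro[OF hecke.subspace_add[OF assms(1)] hecke.subspace_add[OF assms(2)], of a a' b b']
    by (simp add: ac_simps)
next
  fix c x
  assume "x \<in> A + B"
  then show "c \<cdot> x \<in> A + B"
    using hecke.subspace_scale[OF assms(1)] hecke.subspace_scale[OF assms(2)]
    by (auto elim!: set_plus_elim simp: hecke.scale_right_distrib intro!: set_plus_intro)
qed

lemma subspace_set_sum:
  "(\<And>i. i \<in> I \<Longrightarrow> hecke.subspace (A i)) \<Longrightarrow> hecke.subspace (\<Sum>i\<in>I. A i)"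
  by (induction I rule: infinite_finite_induct)
     (auto simp: set_zero intro: subspace_set_plus)

lemma subset_set_plus:
  assumes "hecke.subspace A" "hecke.subspace B"
  shows "A \<subseteq> A + B" "B \<subseteq> A + B"
  using set_plus_intro[OF _ hecke.subspace_0[OF assms(2)], of _ A]
    set_plus_intro[OF hecke.subspace_0[OF assms(1)], of _ B] by auto

lemma subset_set_sum:
  assumes "finite I" "\<And>i. i \<in> I \<Longrightarrow> hecke.subspace (A i)" "i \<in> I"
  shows "A i \<subseteq> (\<Sum>i\<in>I. A i)"
  using subset_set_plus(1)[OF assms(2)[OF assms(3)] subspace_set_sum[of "I - {i}" A]] assms
  by (simp add: sum.remove)

lemma span_prodI: "x \<in> X \<Longrightarrow> y \<in> Y \<Longrightarrow> x * y \<in> X \<odot> Y"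
  unfolding span_prod_def by (rule hecke.span_base) blast

lemma subspace_span_prod: "hecke.subspace (X \<odot> Y)"
  unfolding span_prod_def by (rule hecke.subspace_span)

lemma hecke_u1_mem: "1 \<in> hecke_u1" "hecke_s \<in> hecke_u1"
  by (auto simp: hecke_u1_def hull_def subalgebra_def)

lemma hecke_u2_mem: "1 \<in> hecke_u2" "hecke_t \<in> hecke_u2" "hecke_ti \<in> hecke_u2"
proof -
  show "1 \<in> hecke_u2" "hecke_t \<in> hecke_u2"
    by (auto simp: hecke_u2_def hull_def subalgebra_def)
  \<comment> \<open>As a polynomial in \<open>t\<close>, the inverse lies in every subalgebra
    containing \<open>t\<close>.\<close>
  obtain a b c where ti: "hecke_ti = a \<cdot> 1 - b \<cdot> hecke_t + c \<cdot> (hecke_t * hecke_t)"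
    by (rule hecke_ti_eq)
  have "hecke_ti \<in> A" if "subalgebra A" "hecke_t \<in> A" for A
    using that unfolding ti subalgebra_def
    by (intro hecke.subspace_add hecke.subspace_diff hecke.subspace_scale) auto
  then show "hecke_ti \<in> hecke_u2"
    by (auto simp: hecke_u2_def hull_def)
qed

lemma hecke_gens_subset_U: "hecke_gens \<subseteq> hecke_U"
proof
  fix y
  assume "y \<in> hecke_gens"
  then obtain k u w v where y: "y = hecke_z ^ k * u * w * v" "k \<le> 5" "u \<in> {1, hecke_s}"
      "w \<in> middle_factors" "v \<in> {1, hecke_t, hecke_ti}"
    by (rule hecke_gensE)
  let ?A = "\<lambda>k. {hecke_z ^ k} \<odot> hecke_u1 \<odot> hecke_u2 \<odot> hecke_u1 \<odot> hecke_u2"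
  let ?B = "\<lambda>k. {hecke_z ^ k} \<odot> hecke_u1 \<odot> {hecke_t * hecke_s * hecke_ti * hecke_s} \<odot> hecke_u2"
  have uv: "u \<in> hecke_u1" "v \<in> hecke_u2"
    using y(3,5) hecke_u1_mem hecke_u2_mem by auto
  have A: "y \<in> ?A k" if "b \<in> hecke_u2" "c \<in> hecke_u1" "w = b * c" for b c
    unfolding y(1) that(3) mult.assoc[symmetric] by (intro span_prodI uv that singletonI)
  have B: "y \<in> ?B k" if "w = hecke_t * hecke_s * hecke_ti * hecke_s"
    unfolding y(1) that by (intro span_prodI uv singletonI)
  \<comment> \<open>Three middle factors split as an element of \<open>hecke_u2\<close> times one of
    \<open>hecke_u1\<close>, with 1 written as \<open>1 * 1\<close> to fit; the fourth is placed in
    the second summand of \<open>hecke_U\<close>.\<close>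
  have "w = 1 * 1 \<or> w = hecke_t * hecke_s \<or> w = hecke_ti * hecke_s \<or>
      w = hecke_t * hecke_s * hecke_ti * hecke_s"
    using y(4) by (simp add: middle_factors_def)
  then have "y \<in> ?A k \<or> y \<in> ?B k"
    using A[OF hecke_u2_mem(1) hecke_u1_mem(1)] A[OF hecke_u2_mem(2) hecke_u1_mem(2)]
      A[OF hecke_u2_mem(3) hecke_u1_mem(2)] B by argo
  then have "y \<in> ?A k + ?B k"
    using subset_set_plus[OF subspace_span_prod subspace_span_prod] by blast
  also have "\<dots> \<subseteq> hecke_U"
    unfolding hecke_U_def using y(2)
    by (intro subset_set_sum subspace_set_plus subspace_span_prod) auto
  finally show "y \<in> hecke_U" .
qed

lemma subspace_hecke_U: "hecke.subspace hecke_U"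
  unfolding hecke_U_def by (intro subspace_set_sum subspace_set_plus subspace_span_prod)

theorem theorem4p3p42:
  shows "(UNIV :: hecke set) = hecke_U"
  using hecke.span_minimal[OF hecke_gens_subset_U subspace_hecke_U] span_gens_eq_UNIV by auto

end
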